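(* Let $w \in \mathfrak{S}_n$ and $k \in [1,n-1]$. Then $\max_k(w) > 1$ if and only if $w$ has an occurrence of the pattern $321$ or of the pattern $3412$ that straddles $k$ both in position and in value.
   Context: $\mathfrak{S}_n$ is the symmetric group on $[1,n]$, written in one-line notation $w=w(1)\cdots w(n)$; $\sigma_i$ is the simple reflection exchanging $i$ and $i+1$. $\max_k(w)$ is the maximum, over all reduced decompositions (minimal-length expressions as products of simple reflections) of $w$, of the number of occurrences of the factor $\sigma_k$. An occurrence of $321$ in $w$ is a triple of positions $i_1<i_2<i_3$ with $w(i_1)>w(i_2)>w(i_3)$; an occurrence of $3412$ is a quadruple of positions $i_1<i_2<i_3<i_4$ with $w(i_3)<w(i_4)<w(i_1)<w(i_2)$. A $321$-occurrence in positions $i_1<i_2<i_3$ straddles $k$ in position if $i_1\le k<i_3$; a $321$-occurrence with values $j_1<j_2<j_3$ straddles $k$ in value if $j_1\le k<j_3$. A $3412$-occurrence in positions $i_1<i_2<i_3<i_4$ straddles $k$ in position if $i_2\le k<i_3$; a $3412$-occurrence with values $j_1<j_2<j_3<j_4$ straddles $k$ in value if $j_2\le k<j_3$. A single occurrence straddles $k$ in both position and value if it satisfies both conditions. *)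

theory Defs
  imports "HOL-Combinatorics.Permutations"
begin

text \<open>
  The symmetric group on \<open>{1..n}\<close> is represented by the functions \<open>w :: nat \<Rightarrow> nat\<close> with
  \<open>w permutes {1..n}\<close>; the one-line notation of \<open>w\<close> is \<open>w 1, \<dots>, w n\<close>.
\<close>

definition simple_reflection :: "nat \<Rightarrow> nat \<Rightarrow> nat" where
  "simple_reflection i = transpose i (Suc i)"

text \<open>The word \<open>[i\<^sub>1, \<dots>, i\<^sub>l]\<close> stands for the product of the simple reflections with these indices;
  products are compositions of functions, the rightmost factor being applied first.\<close>

definition word_prod :: "nat list \<Rightarrow> nat \<Rightarrow> nat" where
  "word_prod s = foldr (\<lambda>i f. simple_reflection i \<circ> f) s id"

definition is_word_for :: "nat \<Rightarrow> (nat \<Rightarrow> nat) \<Rightarrow> nat list \<Rightarrow> bool" where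
  "is_word_for n w s \<longleftrightarrow> set s \<subseteq> {1..<n} \<and> word_prod s = w"

definition reduced_words :: "nat \<Rightarrow> (nat \<Rightarrow> nat) \<Rightarrow> nat list set" where
  "reduced_words n w =
     {s. is_word_for n w s \<and> (\<forall>t. is_word_for n w t \<longrightarrow> length s \<le> length t)}"

text \<open>The maximum below is over a finite set, because all reduced words have the same length and
  use letters from a finite alphabet; it is nonempty whenever \<open>w permutes {1..n}\<close>, because the
  simple reflections generate the symmetric group.\<close>

definition max_occ :: "nat \<Rightarrow> nat \<Rightarrow> (nat \<Rightarrow> nat) \<Rightarrow> nat" where
  "max_occ n k w = Max ((\<lambda>s. count_list s k) ` reduced_words n w)"

lemma finite_reduced_words: "finite (reduced_words n w)"
proof (cases "reduced_words n w = {}")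
  case False
  then obtain s where s: "s \<in> reduced_words n w"
    by blast
  have "reduced_words n w \<subseteq> {t. set t \<subseteq> {1..<n} \<and> length t = length s}"
    using s by (auto simp: reduced_words_def is_word_for_def intro: antisym)
  then show ?thesis
    by (rule finite_subset) (simp add: finite_lists_length_eq)
qed simp

definition occurs_321 :: "nat \<Rightarrow> (nat \<Rightarrow> nat) \<Rightarrow> nat \<Rightarrow> nat \<Rightarrow> nat \<Rightarrow> bool" where
  "occurs_321 n w i1 i2 i3 \<longleftrightarrow>
     1 \<le> i1 \<and> i1 < i2 \<and> i2 < i3 \<and> i3 \<le> n \<and> w i1 > w i2 \<and> w i2 > w i3"

definition occurs_3412 :: "nat \<Rightarrow> (nat \<Rightarrow> nat) \<Rightarrow> nat \<Rightarrow> nat \<Rightarrow> nat \<Rightarrow> nat \<Rightarrow> bool" where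
  "occurs_3412 n w i1 i2 i3 i4 \<longleftrightarrow>
     1 \<le> i1 \<and> i1 < i2 \<and> i2 < i3 \<and> i3 < i4 \<and> i4 \<le> n \<and>
     w i3 < w i4 \<and> w i4 < w i1 \<and> w i1 < w i2"

text \<open>The arguments are the positions, or the values, of the occurrence, in increasing order.\<close>

definition straddles_321 :: "nat \<Rightarrow> nat \<Rightarrow> nat \<Rightarrow> nat \<Rightarrow> bool" where
  "straddles_321 k a1 a2 a3 \<longleftrightarrow> a1 \<le> k \<and> k < a3"

definition straddles_3412 :: "nat \<Rightarrow> nat \<Rightarrow> nat \<Rightarrow> nat \<Rightarrow> nat \<Rightarrow> bool" where
  "straddles_3412 k a1 a2 a3 a4 \<longleftrightarrow> a2 \<le> k \<and> k < a3"

end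

theory Submission
  imports Defs
begin

text \<open>
  Call \<open>w\<close> crossing at \<open>k\<close> if it does not preserve \<open>{1..k}\<close>, and doubly crossing if it sends at
  least two elements of \<open>{1..k}\<close> above \<open>k\<close>. A straddling occurrence exists iff \<open>w\<close> is doubly
  crossing or has a straddling \<open>321\<close>. This condition persists when a letter is appended to a
  reduced word, and appending the letter \<open>k\<close> to a reduced word of a crossing permutation creates it.
  Conversely, a permutation satisfying the condition has a descent whose removal either keeps the
  condition, or is at \<open>k\<close> and leaves a crossing permutation, each of whose words contains \<open>k\<close>.
\<close>

section \<open>Inversions and reduced words\<close>

lemma simple_reflection_apply [simp]:
  "simple_reflection p p = Suc p"
  "simple_reflection p (Suc p) = p"
  "x \<noteq> p \<Longrightarrow> x \<noteq> Suc p \<Longrightarrow> simple_reflection p x = x"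
  by (simp_all add: simple_reflection_def)

lemma simple_reflection_involutive [simp]:
  "simple_reflection p (simple_reflection p x) = x"
  "simple_reflection p \<circ> simple_reflection p = id"
  by (simp_all add: simple_reflection_def)

lemma simple_reflection_less:
  assumes "a < b" and "(a, b) \<noteq> (p, Suc p)"
  shows "simple_reflection p a < simple_reflection p b"
  using assms by (auto simp: simple_reflection_def transpose_def)

lemma simple_reflection_mem:
  assumes "p \<in> {1..<n}"
  shows "simple_reflection p x \<in> {1..n} \<longleftrightarrow> x \<in> {1..n}"
  using assms by (auto simp: simple_reflection_def transpose_def)

text \<open>For \<open>p \<noteq> k\<close> the positions \<open>p\<close> and \<open>Suc p\<close>
  lie on the same side of \<open>k\<close>. Hence only the letter \<open>k\<close> can move a
  position across \<open>k\<close>.\<close>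

lemma simple_reflection_le_iff:
  assumes "p \<noteq> k"
  shows "simple_reflection p x \<le> k \<longleftrightarrow> x \<le> k"
  using assms by (auto simp: simple_reflection_def transpose_def)

lemma permutes_comp_simple_reflection:
  assumes "w permutes {1..n}" and "p \<in> {1..<n}"
  shows "w \<circ> simple_reflection p permutes {1..n}"
  unfolding simple_reflection_def
  using assms by (intro permutes_compose permutes_swap_id) auto

lemma word_prod_Nil: "word_prod [] = id"
  by (simp add: word_prod_def)

text \<open>The rightmost factor acts first, so appending \<open>p\<close> swaps the entries in
  positions \<open>p\<close> and \<open>Suc p\<close> and leaves the set of values alone.\<close>

lemma word_prod_snoc: "word_prod (s @ [p]) = word_prod s \<circ> simple_reflection p"
  unfolding word_prod_def by (induction s) (auto simp: comp_assoc)

lemma word_prod_permutes: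
  assumes "set s \<subseteq> {1..<n}"
  shows "word_prod s permutes {1..n}"
  using assms
proof (induction s rule: rev_induct)
  case (snoc p s)
  then show ?case
    unfolding word_prod_snoc by (intro permutes_comp_simple_reflection) auto
qed (simp add: word_prod_Nil permutes_id)

section \<open>The inversion number as the length of reduced words\<close>

definition inversions :: "nat \<Rightarrow> (nat \<Rightarrow> nat) \<Rightarrow> (nat \<times> nat) set" where
  "inversions n w = {(a, b). 1 \<le> a \<and> a < b \<and> b \<le> n \<and> w b < w a}"

lemma finite_inversions: "finite (inversions n w)"
  by (rule finite_subset[of _ "{1..n} \<times> {1..n}"]) (auto simp: inversions_def)

text \<open>Relabelling both positions by the reflection carries the old inversions injectively to
  the new ones. The only new inversion not reached is the swapped pair
  \<open>(p, Suc p)\<close>.\<close>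

lemma card_inversions_ascent:
  assumes p: "p \<in> {1..<n}" and asc: "w p < w (Suc p)"
  shows "card (inversions n (w \<circ> simple_reflection p)) = Suc (card (inversions n w))"
proof -
  let ?t = "simple_reflection p"
  let ?f = "\<lambda>(a, b). (?t a, ?t b)"
  have "inversions n (w \<circ> ?t) = insert (p, Suc p) (?f ` inversions n w)"
  proof (intro equalityI subsetI)
    fix x assume x: "x \<in> inversions n (w \<circ> ?t)"
    obtain a b where ab: "x = (a, b)" by (cases x)
    show "x \<in> insert (p, Suc p) (?f ` inversions n w)"
    proof (cases "(a, b) = (p, Suc p)")
      case False
      have "?t a < ?t b"
        using x ab False by (intro simple_reflection_less) (auto simp: inversions_def)
      then have "(?t a, ?t b) \<in> inversions n w"
        using x ab simple_reflection_mem[OF p, of a] simple_reflection_mem[OF p, of b]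
        by (auto simp: inversions_def)
      then show ?thesis
        using ab by (intro insertI2 image_eqI[of _ _ "(?t a, ?t b)"]) auto
    qed (use ab in simp)
  next
    fix x assume "x \<in> insert (p, Suc p) (?f ` inversions n w)"
    then consider "x = (p, Suc p)"
      | a b where "(a, b) \<in> inversions n w" "x = (?t a, ?t b)" by auto
    then show "x \<in> inversions n (w \<circ> ?t)"
    proof cases
      case 1
      then show ?thesis using p asc by (auto simp: inversions_def)
    next
      case 2
      \<comment> \<open>By \<open>asc\<close>, \<open>(p, Suc p)\<close> is not an inversion of
        \<open>w\<close>, and no other increasing pair is reversed by the reflection.\<close>
      have "?t a < ?t b"
        using 2 asc by (intro simple_reflection_less) (auto simp: inversions_def)
      then show ?thesis
        using 2 simple_reflection_mem[OF p, of a] simple_reflection_mem[OF p, of b]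
        by (auto simp: inversions_def)
    qed
  qed
  moreover have "(p, Suc p) \<notin> ?f ` inversions n w"
  proof
    assume "(p, Suc p) \<in> ?f ` inversions n w"
    then obtain a b where ab: "(a, b) \<in> inversions n w" "?t a = p" "?t b = Suc p" by auto
    then have "a = Suc p" "b = p"
      using ab(2,3) by (auto simp: simple_reflection_def transpose_def split: if_splits)
    then show False using ab by (auto simp: inversions_def)
  qed
  moreover have "inj_on ?f (inversions n w)"
    by (rule inj_on_inverseI[where g = ?f]) auto
  ultimately show ?thesis
    by (simp only: card_insert_disjoint finite_imageI finite_inversions card_image not_False_eq_True)
qed

text \<open>The ascent case read backwards: swapping at a descent leaves an ascent there, and
  swapping again restores \<open>w\<close>.\<close>

lemma card_inversions_descent:
  assumes "p \<in> {1..<n}" and "w (Suc p) < w p"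
  shows "card (inversions n w) = Suc (card (inversions n (w \<circ> simple_reflection p)))"
  using card_inversions_ascent[of p n "w \<circ> simple_reflection p"] assms
  by (simp add: comp_assoc)

lemma permutes_neq_Suc:
  assumes "w permutes S"
  shows "w p \<noteq> w (Suc p)"
  using inj_eq[OF permutes_inj[OF assms]] by simp

lemma card_inversions_le_length:
  assumes "set s \<subseteq> {1..<n}"
  shows "card (inversions n (word_prod s)) \<le> length s"
  using assms
proof (induction s rule: rev_induct)
  case Nil
  have "inversions n id = {}" by (auto simp: inversions_def)
  then show ?case by (simp only: word_prod_Nil card.empty)
next
  case (snoc p s)
  let ?w = "word_prod s"
  have p: "p \<in> {1..<n}" and IH: "card (inversions n ?w) \<le> length s" using snoc by auto
  have "?w permutes {1..n}" using snoc.prems by (intro word_prod_permutes) simp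
  then consider "?w p < ?w (Suc p)" | "?w (Suc p) < ?w p"
    using permutes_neq_Suc by (metis linorder_neqE_nat)
  then have "card (inversions n (?w \<circ> simple_reflection p)) \<le> Suc (length s)"
  proof cases
    case 1 show ?thesis using card_inversions_ascent[OF p 1] IH by simp
  next
    case 2 show ?thesis using card_inversions_descent[OF p 2] IH by simp
  qed
  then show ?case by (simp only: word_prod_snoc length_append_singleton)
qed

lemma permutes_no_descent:
  assumes w: "w permutes {1..n}" and asc: "\<And>p. p \<in> {1..<n} \<Longrightarrow> w p < w (Suc p)"
  shows "w = id"
proof (rule permutes_natset_ge[OF w])
  have "i \<in> {1..n} \<longrightarrow> i \<le> w i" for i
  proof (induction i)
    case (Suc i)
    show ?case
    proof (cases "i = 0")
      case True
      then show ?thesis using permutes_in_image[OF w, of 1] by auto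
    next
      case False
      then show ?thesis using Suc asc[of i] by auto
    qed
  qed simp
  then show "\<forall>i\<in>{1..n}. i \<le> w i" by blast
qed

lemma ex_descent:
  assumes "w permutes {1..n}" and "w \<noteq> id"
  obtains p where "p \<in> {1..<n}" and "w (Suc p) < w p"
  using permutes_no_descent[OF assms(1)] permutes_neq_Suc[OF assms(1)] assms(2)
  by (metis linorder_neqE_nat)

lemma is_word_for_snoc:
  assumes "is_word_for n (w \<circ> simple_reflection p) s" and "p \<in> {1..<n}"
  shows "is_word_for n w (s @ [p])"
  using assms by (auto simp: is_word_for_def word_prod_snoc comp_assoc)

text \<open>Bubble sort: each removed descent costs exactly one inversion and contributes one letter
  at the end of the word.\<close>

lemma ex_word_card_inversions:
  assumes "w permutes {1..n}"
  shows "\<exists>s. is_word_for n w s \<and> length s = card (inversions n w)"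
  using assms
proof (induction "card (inversions n w)" arbitrary: w rule: less_induct)
  case less
  show ?case
  proof (cases "w = id")
    case True
    then have "inversions n w = {}" by (auto simp: inversions_def)
    then show ?thesis using True by (intro exI[of _ "[]"]) (simp add: is_word_for_def word_prod_Nil)
  next
    case False
    then obtain p where p: "p \<in> {1..<n}" "w (Suc p) < w p"
      using ex_descent less.prems by blast
    note inv = card_inversions_descent[OF p]
    obtain s where s: "is_word_for n (w \<circ> simple_reflection p) s"
      "length s = card (inversions n (w \<circ> simple_reflection p))"
      using less.hyps permutes_comp_simple_reflection[OF less.prems p(1)] inv by auto
    then show ?thesis
      using is_word_for_snoc[OF s(1) p(1)] inv by (intro exI[of _ "s @ [p]"]) simp
  qed
qed

text \<open>The inversion number bounds every word length from below and is attained. This replaces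
  the minimality over all words by an equation that suits induction.\<close>

lemma reduced_words_iff:
  assumes "w permutes {1..n}"
  shows "s \<in> reduced_words n w \<longleftrightarrow> is_word_for n w s \<and> length s = card (inversions n w)"
proof -
  have le: "card (inversions n w) \<le> length t" if "is_word_for n w t" for t
    using that card_inversions_le_length by (auto simp: is_word_for_def)
  obtain t where t: "is_word_for n w t" "length t = card (inversions n w)"
    using ex_word_card_inversions[OF assms] by blast
  show ?thesis
  proof
    assume s: "s \<in> reduced_words n w"
    then have "is_word_for n w s" "length s \<le> length t"
      using t(1) by (simp_all add: reduced_words_def)
    then show "is_word_for n w s \<and> length s = card (inversions n w)"
      using t(2) le[of s] by simp
  next
    assume "is_word_for n w s \<and> length s = card (inversions n w)"
    then show "s \<in> reduced_words n w"
      using le by (simp add: reduced_words_def)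
  qed
qed

section \<open>Crossings\<close>

definition crosses :: "nat \<Rightarrow> nat \<Rightarrow> (nat \<Rightarrow> nat) \<Rightarrow> bool" where
  "crosses n k w \<longleftrightarrow> (\<exists>i j. 1 \<le> i \<and> i \<le> k \<and> k < j \<and> j \<le> n \<and> k < w i \<and> w j \<le> k)"

definition crosses_twice :: "nat \<Rightarrow> (nat \<Rightarrow> nat) \<Rightarrow> bool" where
  "crosses_twice k w \<longleftrightarrow> (\<exists>a b. 1 \<le> a \<and> a < b \<and> b \<le> k \<and> k < w a \<and> k < w b)"

definition straddled_321 :: "nat \<Rightarrow> nat \<Rightarrow> (nat \<Rightarrow> nat) \<Rightarrow> bool" where
  "straddled_321 n k w \<longleftrightarrow>
     (\<exists>i m j. 1 \<le> i \<and> i < m \<and> m < j \<and> j \<le> n \<and> w m < w i \<and> w j < w m \<and>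
        i \<le> k \<and> k < j \<and> w j \<le> k \<and> k < w i)"

lemma straddled_321I:
  assumes "1 \<le> i" "i < m" "m < j" "j \<le> n" "w m < w i" "w j < w m"
    "i \<le> k" "k < j" "w j \<le> k" "k < w i"
  shows "straddled_321 n k w"
  unfolding straddled_321_def using assms by blast

text \<open>The two positions need not be given in order, so their images under a reflection can be
  supplied directly.\<close>

lemma crosses_twiceI:
  assumes "1 \<le> a" "1 \<le> b" "a \<noteq> b" "a \<le> k" "b \<le> k" "k < w a" "k < w b"
  shows "crosses_twice k w"
  unfolding crosses_twice_def using assms by (metis linorder_neqE_nat)

text \<open>The positions with values in \<open>{1..k}\<close> are \<open>?C\<close> and
  \<open>?B\<close>, while \<open>{1..k}\<close> itself splits into \<open>?C\<close> and
  \<open>?A\<close>. Both unions have \<open>k\<close> elements.\<close>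

lemma card_crossings:
  fixes n k :: nat
  assumes w: "w permutes {1..n}" and k: "k \<le> n"
  shows "card {a \<in> {1..k}. k < w a} = card {b \<in> {k<..n}. w b \<le> k}"
proof -
  let ?A = "{a \<in> {1..k}. k < w a}" and ?B = "{b \<in> {k<..n}. w b \<le> k}"
    and ?C = "{a \<in> {1..k}. w a \<le> k}"
  have "w ` (?C \<union> ?B) = {1..k}"
  proof (intro equalityI subsetI)
    fix y assume "y \<in> w ` (?C \<union> ?B)"
    then obtain x where "x \<in> ?C \<union> ?B" and y: "y = w x" by blast
    then have "x \<in> {1..n} \<and> w x \<le> k" using k by force
    then show "y \<in> {1..k}" using permutes_in_image[OF w, of x] y by auto
  next
    fix y assume y: "y \<in> {1..k}"
    then have "y \<in> w ` {1..n}" using k permutes_image[OF w] by auto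
    then show "y \<in> w ` (?C \<union> ?B)" using y by force
  qed
  moreover have "card (w ` (?C \<union> ?B)) = card (?C \<union> ?B)"
    by (rule card_image) (rule permutes_inj_on[OF w])
  moreover have "card (?C \<union> ?B) = card ?C + card ?B"
    by (rule card_Un_disjoint) auto
  moreover have "card {1..k} = card (?C \<union> ?A)"
    by (rule arg_cong[where f = card]) auto
  moreover have "card (?C \<union> ?A) = card ?C + card ?A"
    by (rule card_Un_disjoint) auto
  ultimately show ?thesis by simp
qed

lemma card_le_Suc0_iff_no_less:
  fixes S :: "'a :: linorder set"
  assumes "finite S"
  shows "card S \<le> Suc 0 \<longleftrightarrow> \<not> (\<exists>a\<in>S. \<exists>b\<in>S. a < b)"
  unfolding card_le_Suc0_iff_eq[OF assms] by (metis linorder_neqE less_irrefl)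

lemma crosses_twice_iff_downward:
  assumes "w permutes {1..n}" and "k \<le> n"
  shows "crosses_twice k w \<longleftrightarrow> (\<exists>c d. k < c \<and> c < d \<and> d \<le> n \<and> w c \<le> k \<and> w d \<le> k)"
proof -
  let ?A = "{a \<in> {1..k}. k < w a}" and ?B = "{b \<in> {k<..n}. w b \<le> k}"
  have "crosses_twice k w \<longleftrightarrow> (\<exists>a\<in>?A. \<exists>b\<in>?A. a < b)"
    unfolding crosses_twice_def by fastforce
  also have "\<dots> \<longleftrightarrow> \<not> card ?A \<le> Suc 0"
    by (subst card_le_Suc0_iff_no_less) auto
  also have "\<dots> \<longleftrightarrow> \<not> card ?B \<le> Suc 0"
    using card_crossings[OF assms] by simp
  also have "\<dots> \<longleftrightarrow> (\<exists>c\<in>?B. \<exists>d\<in>?B. c < d)"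
    by (subst card_le_Suc0_iff_no_less) auto
  also have "\<dots> \<longleftrightarrow> (\<exists>c d. k < c \<and> c < d \<and> d \<le> n \<and> w c \<le> k \<and> w d \<le> k)"
    by fastforce
  finally show ?thesis .
qed

text \<open>The two large entries of a straddling 3412 cross upward. Conversely, take two upward and
  two downward crossings: if either pair is decreasing, it forms a 321 with an entry of the other
  pair; if both increase, the four entries form a 3412.\<close>

lemma straddling_pattern_iff:
  assumes w: "w permutes {1..n}" and k: "k \<le> n"
  shows "(\<exists>i1 i2 i3. occurs_321 n w i1 i2 i3 \<and> straddles_321 k i1 i2 i3 \<and>
        straddles_321 k (w i3) (w i2) (w i1)) \<or>
      (\<exists>i1 i2 i3 i4. occurs_3412 n w i1 i2 i3 i4 \<and> straddles_3412 k i1 i2 i3 i4 \<and>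
        straddles_3412 k (w i3) (w i4) (w i1) (w i2)) \<longleftrightarrow>
    crosses_twice k w \<or> straddled_321 n k w"
    (is "?P321 \<or> ?P3412 \<longleftrightarrow> _")
proof -
  have 1: "?P321 \<longleftrightarrow> straddled_321 n k w"
    unfolding occurs_321_def straddles_321_def straddled_321_def by blast
  have 2: "crosses_twice k w" if pat: ?P3412
  proof -
    obtain i1 i2 i3 i4 where "occurs_3412 n w i1 i2 i3 i4" "straddles_3412 k i1 i2 i3 i4"
      "straddles_3412 k (w i3) (w i4) (w i1) (w i2)"
      using pat by blast
    then show ?thesis
      unfolding occurs_3412_def straddles_3412_def by (intro crosses_twiceI[of i1 i2]) auto
  qed
  have 3: "straddled_321 n k w \<or> ?P3412" if tw: "crosses_twice k w"
  proof -
    obtain a b where ab: "1 \<le> a" "a < b" "b \<le> k" "k < w a" "k < w b"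
      using tw unfolding crosses_twice_def by blast
    obtain c d where cd: "k < c" "c < d" "d \<le> n" "w c \<le> k" "w d \<le> k"
      using tw crosses_twice_iff_downward[OF w k] by blast
    have "w a \<noteq> w b" "w c \<noteq> w d"
      using inj_eq[OF permutes_inj[OF w]] ab cd by auto
    then consider "w b < w a" | "w d < w c" | "w a < w b" "w c < w d" by linarith
    then show ?thesis
    proof cases
      case 1
      then have "straddled_321 n k w"
        using ab cd by (intro straddled_321I[of a b c]) auto
      then show ?thesis ..
    next
      case 2
      then have "straddled_321 n k w"
        using ab cd by (intro straddled_321I[of a c d]) auto
      then show ?thesis ..
    next
      case 3
      then have "occurs_3412 n w a b c d \<and> straddles_3412 k a b c d \<and>
          straddles_3412 k (w c) (w d) (w a) (w b)"
        using ab cd by (auto simp: occurs_3412_def straddles_3412_def)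
      then show ?thesis by blast
    qed
  qed
  show ?thesis using 1 2 3 by blast
qed

section \<open>From repeated letters to patterns\<close>

lemma crosses_ascent:
  assumes "crosses n k w" and p: "p \<in> {1..<n}" and asc: "w p < w (Suc p)"
  shows "crosses n k (w \<circ> simple_reflection p)"
proof -
  let ?t = "simple_reflection p"
  obtain i j where ij: "1 \<le> i" "i \<le> k" "k < j" "j \<le> n" "k < w i" "w j \<le> k"
    using assms(1) unfolding crosses_def by blast
  show ?thesis
  proof (cases "p = k")
    case False
    have "?t i \<in> {1..n}" "?t j \<in> {1..n}" "?t i \<le> k" "\<not> ?t j \<le> k"
      using ij simple_reflection_mem[OF p] simple_reflection_le_iff[OF False] by auto
    then show ?thesis unfolding crosses_def using ij
      by (intro exI[of _ "?t i"] exI[of _ "?t j"]) auto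
  next
    case True
    \<comment> \<open>The same positions still work: \<open>i = k\<close> now carries
      \<open>w (Suc k)\<close>, which exceeds \<open>w k\<close>, and \<open>j = Suc k\<close> now
      carries \<open>w k\<close>, which is below \<open>w (Suc k)\<close>.\<close>
    have "k < (w \<circ> ?t) i" "(w \<circ> ?t) j \<le> k"
      using ij asc True by (cases "i = k"; cases "j = Suc k"; simp)+
    then show ?thesis unfolding crosses_def using ij by blast
  qed
qed

lemma crosses_ascent_at:
  assumes k: "k \<in> {1..<n}" and asc: "w k < w (Suc k)"
    and "\<not> crosses n k w" and w: "w permutes {1..n}"
  shows "crosses n k (w \<circ> simple_reflection k)"
proof -
  \<comment> \<open>Without a crossing pair one of the two sets is empty; equal cardinality then
    empties the other.\<close>
  have "{a \<in> {1..k}. k < w a} = {} \<or> {b \<in> {k<..n}. w b \<le> k} = {}"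
    using assms(3) unfolding crosses_def by auto
  moreover have "card {a \<in> {1..k}. k < w a} = card {b \<in> {k<..n}. w b \<le> k}"
    using card_crossings[OF w] k by simp
  moreover have "finite {a \<in> {1..k}. k < w a}" "finite {b \<in> {k<..n}. w b \<le> k}"
    by auto
  ultimately have "{a \<in> {1..k}. k < w a} = {}" "{b \<in> {k<..n}. w b \<le> k} = {}"
    by (metis card.empty card_0_eq)+
  then have "\<not> k < w k" "\<not> w (Suc k) \<le> k" using k by auto
  then show ?thesis unfolding crosses_def using k
    by (intro exI[of _ k] exI[of _ "Suc k"]) auto
qed

lemma crosses_twice_ascent:
  assumes "crosses_twice k w" and "1 \<le> p" and asc: "w p < w (Suc p)"
  shows "crosses_twice k (w \<circ> simple_reflection p)"
proof -
  let ?t = "simple_reflection p"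
  obtain a b where ab: "1 \<le> a" "a < b" "b \<le> k" "k < w a" "k < w b"
    using assms(1) unfolding crosses_twice_def by blast
  show ?thesis
  proof (cases "p = k")
    case False
    have "1 \<le> ?t a" "1 \<le> ?t b" "?t a \<noteq> ?t b"
      using ab assms(2) by (auto simp: simple_reflection_def transpose_def)
    moreover have "?t a \<le> k" "?t b \<le> k"
      using ab simple_reflection_le_iff[OF False] by auto
    ultimately show ?thesis using ab
      by (intro crosses_twiceI[of "?t a" "?t b"]) auto
  next
    case True
    have "k < (w \<circ> ?t) a" "k < (w \<circ> ?t) b"
      using ab asc True by (cases "b = k"; simp)+
    then show ?thesis using ab by (intro crosses_twiceI[of a b]) auto
  qed
qed

lemma straddled_321_ascent:
  assumes "straddled_321 n k w" and p: "p \<in> {1..<n}" and asc: "w p < w (Suc p)"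
  shows "straddled_321 n k (w \<circ> simple_reflection p)"
proof -
  let ?t = "simple_reflection p"
  obtain i m j where ijm: "1 \<le> i" "i < m" "m < j" "j \<le> n" "w m < w i" "w j < w m"
      "i \<le> k" "k < j" "w j \<le> k" "k < w i"
    using assms(1) unfolding straddled_321_def by blast
  have less: "?t i < ?t m" "?t m < ?t j"
    using ijm asc by (auto intro!: simple_reflection_less)
  have mem: "?t i \<in> {1..n}" "?t j \<in> {1..n}"
    using ijm simple_reflection_mem[OF p] by auto
  \<comment> \<open>Moving all three entries along with the reflection fails only if an end would
    cross \<open>k\<close>. In that case the end position stays put, and by the ascent its new value
    is even more extreme.\<close>
  consider "p = k" "i = k" | "p = k" "j = Suc k" | "p \<noteq> k" | "p = k" "i \<noteq> k" "j \<noteq> Suc k"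
    by blast
  then show ?thesis
  proof cases
    case 1
    then show ?thesis using ijm less mem asc
      by (intro straddled_321I[of k "?t m" "?t j"]) auto
  next
    case 2
    then show ?thesis using ijm less mem asc
      by (intro straddled_321I[of "?t i" "?t m" "Suc k"]) auto
  next
    case 3
    then have "?t i \<le> k" "\<not> ?t j \<le> k" using ijm simple_reflection_le_iff[OF 3] by auto
    then show ?thesis using ijm less mem
      by (intro straddled_321I[of "?t i" "?t m" "?t j"]) auto
  next
    case 4
    then show ?thesis using ijm less mem
      by (intro straddled_321I[of "?t i" "?t m" "?t j"]) auto
  qed
qed

text \<open>If the swapped values lie on the same side of \<open>k\<close>, they become a descent
  that forms a 321 with an end of the crossing pair. If the ascent straddles \<open>k\<close>,
  swapping adds a second upward crossing.\<close>

lemma straddled_ascent_at: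
  assumes "crosses n k w" and asc: "w k < w (Suc k)"
  shows "crosses_twice k (w \<circ> simple_reflection k) \<or> straddled_321 n k (w \<circ> simple_reflection k)"
proof -
  let ?t = "simple_reflection k"
  obtain i j where ij: "1 \<le> i" "i \<le> k" "k < j" "j \<le> n" "k < w i" "w j \<le> k"
    using assms(1) unfolding crosses_def by blast
  consider "k < w k" | "w (Suc k) \<le> k" | "w k \<le> k" "k < w (Suc k)" by linarith
  then show ?thesis
  proof cases
    case 1
    then have "j \<noteq> Suc k" using ij asc by auto
    then have "straddled_321 n k (w \<circ> ?t)"
      using ij asc 1 by (intro straddled_321I[of k "Suc k" j]) auto
    then show ?thesis ..
  next
    case 2
    then have "i \<noteq> k" using ij asc by auto
    then have "straddled_321 n k (w \<circ> ?t)"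
      using ij asc 2 by (intro straddled_321I[of i k "Suc k"]) auto
    then show ?thesis ..
  next
    case 3
    then have "i \<noteq> k" using ij by auto
    then have "crosses_twice k (w \<circ> ?t)"
      using ij 3 by (intro crosses_twiceI[of i k]) auto
    then show ?thesis ..
  qed
qed

text \<open>A prefix of a reduced word is reduced, so each letter is appended at an ascent. The
  first occurrence of \<open>k\<close> creates a crossing, the second a pattern, and both properties
  persist; hence the two claims share one induction.\<close>

lemma reduced_word_repeated_letter:
  assumes "set s \<subseteq> {1..<n}" and "length s = card (inversions n (word_prod s))"
  shows "(k \<in> set s \<longrightarrow> crosses n k (word_prod s)) \<and>
    (2 \<le> count_list s k \<longrightarrow> crosses_twice k (word_prod s) \<or> straddled_321 n k (word_prod s))"
  using assms
proof (induction s rule: rev_induct)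
  case (snoc p s)
  let ?w = "word_prod s"
  have p: "p \<in> {1..<n}" and s: "set s \<subseteq> {1..<n}" using snoc.prems by auto
  have w: "?w permutes {1..n}" using word_prod_permutes[OF s] .
  have len: "Suc (length s) = card (inversions n (?w \<circ> simple_reflection p))"
    using snoc.prems(2) by (simp only: word_prod_snoc length_append_singleton)
  \<comment> \<open>At a descent, \<open>?w\<close> would have \<open>length s + 2\<close>
    inversions, more than a word of length \<open>length s\<close> allows.\<close>
  have asc: "?w p < ?w (Suc p)"
  proof (rule ccontr)
    assume "\<not> ?thesis"
    then have "?w (Suc p) < ?w p" using permutes_neq_Suc[OF w, of p] by linarith
    from card_inversions_descent[OF p this] show False 
      using len card_inversions_le_length[OF s] by simp
  qed
  have "length s = card (inversions n ?w)"
    using card_inversions_ascent[OF p asc] len by simp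
  note IH = snoc.IH[OF s this]
  show ?case
    unfolding word_prod_snoc
  proof (intro conjI impI)
    assume "k \<in> set (s @ [p])"
    then have "crosses n k ?w \<or> p = k" using IH by auto
    then show "crosses n k (?w \<circ> simple_reflection p)"
      using crosses_ascent[OF _ p asc] crosses_ascent_at[of k n ?w] p asc w by auto
  next
    assume "2 \<le> count_list (s @ [p]) k"
    then consider "2 \<le> count_list s k" | "p = k" "k \<in> set s"
      using count_list_0_iff[of s k] by (cases "count_list s k") (auto split: if_splits)
    then show "crosses_twice k (?w \<circ> simple_reflection p) \<or> straddled_321 n k (?w \<circ> simple_reflection p)"
    proof cases
      case 1
      then show ?thesis
        using IH crosses_twice_ascent[OF _ _ asc] straddled_321_ascent[OF _ p asc] p by auto
    next
      case 2
      then show ?thesis using IH straddled_ascent_at asc by simp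
    qed
  qed
qed simp

section \<open>From patterns to repeated letters\<close>

text \<open>All letters other than \<open>k\<close> keep positions on their side of
  \<open>k\<close>. By contraposition, every word of a crossing permutation contains
  \<open>k\<close>.\<close>

lemma word_prod_le_iff:
  assumes "k \<notin> set s"
  shows "word_prod s x \<le> k \<longleftrightarrow> x \<le> k"
  using assms
  by (induction s arbitrary: x rule: rev_induct) (auto simp: word_prod_Nil word_prod_snoc simple_reflection_le_iff)

lemma crosses_imp_letter:
  assumes "crosses n k w" and "is_word_for n w s"
  shows "k \<in> set s"
  using assms word_prod_le_iff[of k s] unfolding crosses_def is_word_for_def
  by (metis linorder_not_le)

text \<open>Any descent will do: away from \<open>k\<close> both crossings survive, and at
  \<open>k\<close> the swap cannot destroy all of them.\<close>

lemma crosses_twice_imp_descent: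
  assumes w: "w permutes {1..n}" and k: "k \<le> n" and tw: "crosses_twice k w"
  shows "\<exists>p \<in> {1..<n}. w (Suc p) < w p \<and>
    (crosses_twice k (w \<circ> simple_reflection p) \<or> p = k \<and> crosses n k (w \<circ> simple_reflection k))"
proof -
  obtain a b where ab: "1 \<le> a" "a < b" "b \<le> k" "k < w a" "k < w b"
    using tw unfolding crosses_twice_def by blast
  obtain c d where cd: "k < c" "c < d" "d \<le> n" "w c \<le> k" "w d \<le> k"
    using tw crosses_twice_iff_downward[OF w k] by blast
  have "w \<noteq> id" using ab by auto
  then obtain p where p: "p \<in> {1..<n}" "w (Suc p) < w p"
    using ex_descent[OF w] by blast
  let ?t = "simple_reflection p"
  have "crosses_twice k (w \<circ> ?t) \<or> p = k \<and> crosses n k (w \<circ> simple_reflection k)"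
  proof (cases "p = k")
    case True
    \<comment> \<open>The outer witnesses satisfy \<open>a < k\<close> and \<open>Suc k < d\<close>,
      so the swap at \<open>k\<close> fixes both positions.\<close>
    have "crosses n k (w \<circ> simple_reflection k)"
      unfolding crosses_def using ab cd by (intro exI[of _ a] exI[of _ d]) auto
    then show ?thesis using True by simp
  next
    case False
    have "1 \<le> ?t a" "1 \<le> ?t b" "?t a \<noteq> ?t b"
      using ab p by (auto simp: simple_reflection_def transpose_def)
    moreover have "?t a \<le> k" "?t b \<le> k"
      using ab simple_reflection_le_iff[OF False] by auto
    ultimately have "crosses_twice k (w \<circ> ?t)" using ab
      by (intro crosses_twiceI[of "?t a" "?t b"]) auto
    then show ?thesis ..
  qed
  then show ?thesis using p by (intro bexI[of _ p] conjI)
qed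

text \<open>
  With a single crossing pair \<open>(i, j)\<close>, the end of the \<open>321\<close> lying on the other side of \<open>k\<close> than its
  middle can be moved next to \<open>k\<close>, and then the middle entry, chosen closest to \<open>k\<close>, can be moved
  towards \<open>k\<close> until a descent at \<open>k\<close> appears.
\<close>

lemma straddled_321_imp_descent:
  assumes w: "w permutes {1..n}" and k: "k \<le> n" and ntw: "\<not> crosses_twice k w"
    and "straddled_321 n k w"
  shows "\<exists>p \<in> {1..<n}. w (Suc p) < w p \<and>
    (straddled_321 n k (w \<circ> simple_reflection p) \<or> p = k \<and> crosses n k (w \<circ> simple_reflection k))"
proof -
  obtain i m j where ijm: "1 \<le> i" "i < m" "m < j" "j \<le> n" "w m < w i" "w j < w m"
      "i \<le> k" "k < j" "w j \<le> k" "k < w i"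
    using assms(4) unfolding straddled_321_def by blast
  \<comment> \<open>Without a double crossing, \<open>i\<close> is the only upward crossing position
    and \<open>j\<close> the only downward one.\<close>
  have i_unique: "w a \<le> k" if "1 \<le> a" "a \<le> k" "a \<noteq> i" for a
    using ntw crosses_twiceI[of a i k w] that ijm by force
  have j_unique: "k < w b" if "k < b" "b \<le> n" "b \<noteq> j" for b
    using ntw crosses_twice_iff_downward[OF w k] that ijm by (metis linorder_neqE_nat linorder_not_le)
  consider "m \<le> k" "Suc k < j" | "m \<le> k" "j = Suc k" | "k < m" "i < k" | "k < m" "i = k"
    using ijm by linarith
  then show ?thesis
  proof cases
    case 1
    \<comment> \<open>The entry before \<open>j\<close> is above \<open>k\<close> by
      \<open>j_unique\<close>, so there is a descent at \<open>p\<close>, and removing it moves the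
      small end one place towards \<open>k\<close>.\<close>
    define p where "p = j - 1"
    have p: "j = Suc p" "k < p" using 1 by (auto simp: p_def)
    have "k < w p" using j_unique[of p] p ijm by auto
    moreover have "straddled_321 n k (w \<circ> simple_reflection p)"
      using ijm p 1 by (intro straddled_321I[of i m p]) auto
    ultimately show ?thesis using p ijm by (intro bexI[of _ p]) auto
  next
    case 2
    \<comment> \<open>\<open>M\<close> collects the possible middles at or before \<open>k\<close>.
      The rightmost one, \<open>p\<close>, is followed by a descent, since \<open>Suc p\<close> is
      either \<open>j\<close> or a position of \<open>{i<..k}\<close> outside
      \<open>M\<close>.\<close>
    define M where "M = {x \<in> {i<..k}. w j < w x}"
    define p where "p = Max M"
    have M: "finite M" "m \<in> M" using ijm 2 by (auto simp: M_def)
    then have "p \<in> M" unfolding p_def by (intro Max_in) auto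
    then have p: "i < p" "p \<le> k" "w j < w p" by (auto simp: M_def)
    show ?thesis
    proof (cases "p = k")
      case True
      \<comment> \<open>The swap puts the middle value into position \<open>j = Suc k\<close>; it is
        at most \<open>k\<close> by \<open>i_unique\<close>, so \<open>i\<close> and
        \<open>j\<close> still cross.\<close>
      have "crosses n k (w \<circ> simple_reflection k)"
        unfolding crosses_def using ijm p True 2 i_unique[of k]
        by (intro exI[of _ i] exI[of _ j]) auto
      then show ?thesis using True p 2 ijm by (intro bexI[of _ k]) auto
    next
      case False
      have "Suc p \<notin> M" using Max_ge[OF M(1), of "Suc p"] unfolding p_def[symmetric] by auto
      then have "w (Suc p) \<le> w j" using False p by (auto simp: M_def)
      then have desc: "w (Suc p) < w p" using p by simp
      have "w p \<le> k" using i_unique[of p] p ijm by auto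
      then have "straddled_321 n k (w \<circ> simple_reflection p)"
        using ijm p 2 False by (intro straddled_321I[of i "Suc p" j]) auto
      then show ?thesis using desc p ijm by (intro bexI[of _ p]) auto
    qed
  next
    case 3
    \<comment> \<open>Mirror image of the first case: the large end moves one place towards
      \<open>k\<close>.\<close>
    have "w (Suc i) \<le> k" using i_unique[of "Suc i"] 3 by auto
    moreover have "straddled_321 n k (w \<circ> simple_reflection i)"
      using ijm 3 by (intro straddled_321I[of "Suc i" m j]) auto
    ultimately show ?thesis using ijm by (intro bexI[of _ i]) auto
  next
    case 4
    \<comment> \<open>Mirror image of the second case: the leftmost possible middle \<open>q\<close>
      is preceded by \<open>i = k\<close> or by an entry of value at least \<open>w i\<close>, which
      gives a descent at \<open>q - 1\<close>.\<close>
    define M where "M = {x \<in> {k<..<j}. w x < w i}"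
    define q where "q = Min M"
    have M: "finite M" "m \<in> M" using ijm 4 by (auto simp: M_def)
    then have "q \<in> M" unfolding q_def by (intro Min_in) auto
    then have q: "k < q" "q < j" "w q < w i" by (auto simp: M_def)
    define p where "p = q - 1"
    have p: "q = Suc p" "k \<le> p" using q by (auto simp: p_def)
    show ?thesis
    proof (cases "p = k")
      case True
      have "crosses n k (w \<circ> simple_reflection k)"
        unfolding crosses_def using ijm p q True 4 j_unique[of q]
        by (intro exI[of _ i] exI[of _ j]) auto
      then show ?thesis using True p q 4 ijm by (intro bexI[of _ k]) auto
    next
      case False
      have "p \<notin> M" using Min_le[OF M(1), of p] p unfolding q_def[symmetric] by auto
      then have "w i \<le> w p" using False p q by (auto simp: M_def)
      then have desc: "w (Suc p) < w p" using p q by simp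
      have "k < w q" using j_unique[of q] q ijm by auto
      then have "straddled_321 n k (w \<circ> simple_reflection p)"
        using ijm p q 4 False by (intro straddled_321I[of i p j]) auto
      then show ?thesis using desc p q ijm by (intro bexI[of _ p]) auto
    qed
  qed
qed

text \<open>Removing a suitable descent \<open>p\<close> either keeps the condition, so that the
  shorter word already has two letters \<open>k\<close>, or has \<open>p = k\<close> and leaves a
  crossing permutation. In the latter case any of its reduced words contains \<open>k\<close>, and
  the appended \<open>k\<close> is the second.\<close>

lemma ex_reduced_word_repeated_letter:
  assumes "w permutes {1..n}" and k: "k \<le> n" and "crosses_twice k w \<or> straddled_321 n k w"
  shows "\<exists>s. is_word_for n w s \<and> length s = card (inversions n w) \<and> 2 \<le> count_list s k"
  using assms(1,3)
proof (induction "card (inversions n w)" arbitrary: w rule: less_induct)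
  case less
  let ?w = "\<lambda>p. w \<circ> simple_reflection p"
  obtain p where p: "p \<in> {1..<n}" "w (Suc p) < w p"
    and or: "(crosses_twice k (?w p) \<or> straddled_321 n k (?w p)) \<or> p = k \<and> crosses n k (?w k)"
    using crosses_twice_imp_descent[OF less.prems(1) k]
      straddled_321_imp_descent[OF less.prems(1) k] less.prems(2) by blast
  note inv = card_inversions_descent[OF p]
  note w' = permutes_comp_simple_reflection[OF less.prems(1) p(1)]
  obtain s where s: "is_word_for n (?w p) s" "length s = card (inversions n (?w p))"
    "2 \<le> count_list s k \<or> p = k \<and> crosses n k (?w k)"
    using or less.hyps[OF _ w'] inv ex_word_card_inversions[OF w'] by (metis lessI)
  have "2 \<le> count_list (s @ [p]) k"
    using s(3)
  proof
    assume "p = k \<and> crosses n k (?w k)"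
    then have "k \<in> set s" "p = k" using crosses_imp_letter s(1) by auto
    then show ?thesis using count_list_0_iff[of s k] by (cases "count_list s k") auto
  qed simp
  then show ?case
    using is_word_for_snoc[OF s(1) p(1)] s(2) inv by (intro exI[of _ "s @ [p]"]) simp
qed

theorem theorem3p3:
  fixes n k :: nat and w :: "nat \<Rightarrow> nat"
  assumes "w permutes {1..n}"
    and "1 \<le> k" and "k \<le> n - 1"
  shows "max_occ n k w > 1 \<longleftrightarrow>
    (\<exists>i1 i2 i3. occurs_321 n w i1 i2 i3 \<and>
       straddles_321 k i1 i2 i3 \<and>
       straddles_321 k (w i3) (w i2) (w i1)) \<or>
    (\<exists>i1 i2 i3 i4. occurs_3412 n w i1 i2 i3 i4 \<and>
       straddles_3412 k i1 i2 i3 i4 \<and>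
       straddles_3412 k (w i3) (w i4) (w i1) (w i2))"
proof -
  have k: "k \<le> n" using assms by simp
  \<comment> \<open>Nonemptiness, together with finiteness, makes \<open>Max\<close> a genuine
    maximum, so that it exceeds 1 exactly when some reduced word does.\<close>
  have "reduced_words n w \<noteq> {}"
    using ex_word_card_inversions[OF assms(1)] reduced_words_iff[OF assms(1)] by blast
  then have "max_occ n k w > 1 \<longleftrightarrow> (\<exists>s \<in> reduced_words n w. 2 \<le> count_list s k)"
    unfolding max_occ_def
    by (subst Max_gr_iff) (auto simp: finite_reduced_words Suc_le_eq numeral_2_eq_2)
  also have "\<dots> \<longleftrightarrow> crosses_twice k w \<or> straddled_321 n k w"
    using ex_reduced_word_repeated_letter[OF assms(1) k] reduced_word_repeated_letter[of _ n k]
    unfolding Bex_def reduced_words_iff[OF assms(1)] is_word_for_def by metis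
  finally show ?thesis
    unfolding straddling_pattern_iff[OF assms(1) k] .
qed

end
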